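(* For every fixed $\alpha,c>0$ and fixed $\Delta>0$ there exists a constant $\beta>0$ such that the following holds. If $G$ is a graph on $n$ vertices of maximum degree at most $\Delta$ which is an $f$-expander for a function $f:\{1,\dots,\lfloor n/2\rfloor\}\to\mathbb{R}^+$ with $f\ge c$, and $\widehat{G}$ is the random graph obtained from $G$ by deleting every vertex independently with probability $p=n^{-\alpha}$, then w.h.p. $\widehat{G}$ has a connected component of size $n-o(n)$ that is a $\beta$-expander, and every other connected component of $\widehat{G}$ has at most $K-1$ vertices, where $$K=\min\left\{u\;:\;\forall k\geq u\quad k f(k)>\frac{1}{\alpha}\right\}.$$
   Context: Graphs are finite and simple. For a graph $G=(V,E)$ and $U\subseteq V$, $N_G(U)=\{v\in V\setminus U: v\text{ has a neighbor in }U\}$. A graph $H$ on $m$ vertices is an $f$-expander, for $f:\{1,\dots,\lfloor m/2\rfloor\}\to\mathbb{R}^+$, if every nonempty set $U$ of at most $m/2$ vertices satisfies $|N_H(U)|\ge f(|U|)\cdot|U|$; it is a $\beta$-expander ($\beta>0$ constant) if this holds with $f$ constantly equal to $\beta$. A connected component is called a $\beta$-expander if the subgraph it induces is a $\beta$-expander with respect to its own number of vertices. $f\ge c$ means $f(a)\ge c$ for all $a$ in the domain of $f$. In the definition of $K$, $u$ and $k$ range over $\{1,\dots,\lfloor n/2\rfloor\}$, the domain of $f$ ($K$ is well defined for large $n$ since $f\ge c$). Deletion process: each vertex of $V$ is deleted independently with probability $p=n^{-\alpha}$; $\widehat{G}$ is the subgraph of $G$ induced by the non-deleted vertices. Asymptotics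 are as $n\to\infty$: the statement is about every family $\{G_n\}$ of graphs ($G_n$ on $n$ vertices) satisfying the hypotheses (with $f=f_n$ possibly depending on $n$, and $\alpha,c,\Delta$ fixed), and an event holds w.h.p. (with high probability) if its probability tends to $1$ as $n\to\infty$. "Size" means number of vertices. *)

theory Defs
  imports
    "HOL-Probability.Probability"
    "HOL-Library.Landau_Symbols"
    "Graph_Theory.Graph_Theory"
begin

text \<open>
  A finite simple graph is a digraph satisfying the locale predicate \<^locale>\<open>graph\<close>: finite,
  loop-free, without parallel arcs and symmetric. Every undirected edge is thus a pair of opposite
  arcs, and the degree of a vertex is its \<^const>\<open>out_degree\<close>.
\<close>

definition ext_neighbours :: "('a, 'b) pre_digraph \<Rightarrow> 'a set \<Rightarrow> 'a set" where
  "ext_neighbours G U = {v \<in> verts G - U. \<exists>u\<in>U. u \<rightarrow>\<^bsub>G\<^esub> v}"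

text \<open>
  Only the values of \<open>f\<close> on \<open>{1..m div 2}\<close> matter, where \<open>m\<close> is the number of vertices of \<open>H\<close>.
\<close>

definition expander :: "(nat \<Rightarrow> real) \<Rightarrow> ('a, 'b) pre_digraph \<Rightarrow> bool" where
  "expander f H \<longleftrightarrow>
     (\<forall>a\<in>{1..card (verts H) div 2}. 0 < f a) \<and>
     (\<forall>U. U \<subseteq> verts H \<and> U \<noteq> {} \<and> real (card U) \<le> real (card (verts H)) / 2 \<longrightarrow>
          f (card U) * real (card U) \<le> real (card (ext_neighbours H U)))"

abbreviation const_expander :: "real \<Rightarrow> ('a, 'b) pre_digraph \<Rightarrow> bool" where
  "const_expander \<beta> \<equiv> expander (\<lambda>_. \<beta>)"

text \<open>
  The constant \<open>connected\<close> of the graph library is qualified because it is otherwise hidden by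
  topological connectedness.
\<close>

definition graph_component :: "('a, 'b) pre_digraph \<Rightarrow> ('a, 'b) pre_digraph \<Rightarrow> bool" where
  "graph_component H C \<longleftrightarrow> pre_digraph.max_subgraph H Digraph_Component.connected C"

lemma (in sym_digraph) graph_component_iff_sccs: "graph_component G C \<longleftrightarrow> C \<in> sccs"
proof -
  let ?conn = "Digraph_Component.connected :: ('a, 'b) pre_digraph \<Rightarrow> bool"
  have sc_conn: "?conn H" if "subgraph H G" "strongly_connected H" for H
  proof -
    interpret H: wf_digraph H using that(1) by (simp add: subgraph_def)
    show ?thesis
      using that(2) H.reachable_mk_symmetricI
      unfolding Digraph_Component.connected_def strongly_connected_def by auto
  qed
  have conn_sc: "strongly_connected H" if H: "induced_subgraph H G" "?conn H" for H
    using wf_digraph.symmetric_connected_imp_strongly_connected[OF wf_digraphI_induced[OF H(1)]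
        induced_graph_imp_symmetric[OF sym_arcs H(1)] H(2)] .
  have mono: "arc_mono ?conn"
    unfolding arc_mono_def
  proof (intro allI impI, elim conjE)
    fix H1 H2 :: "('a, 'b) pre_digraph"
    assume H: "?conn H1" "subgraph H1 H2" "verts H1 = verts H2"
    then have "wf_digraph H2" "spanning H1 H2"
      by (simp_all add: subgraph_def spanning_def)
    then show "?conn H2"
      using H(1) by (rule wf_digraph.connected_spanning_imp_connected)
  qed
  have "max_subgraph ?conn C \<longleftrightarrow> max_subgraph strongly_connected C"
  proof
    assume C: "max_subgraph ?conn C"
    then have "strongly_connected C"
      using conn_sc induced_subgraphI_arc_mono[OF C mono] max_subgraph_prop by blast
    with C sc_conn show "max_subgraph strongly_connected C"
      unfolding max_subgraph_def by blast
  next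
    assume C: "max_subgraph strongly_connected C"
    have "H = C" if H: "subgraph C H" "subgraph H G" "?conn H" for H
    proof -
      let ?H = "G \<restriction> verts H"
      have sub: "subgraph H ?H" "subgraph ?H G" "induced_subgraph ?H G"
        using H by (auto simp: subgraph_induce_subgraphI2 subgraph_induce_subgraphI)
      then have "?conn ?H" using mono H(3) unfolding arc_mono_def by fastforce
      then have "strongly_connected ?H" using conn_sc sub by blast
      then have "C = ?H"
        using C sub(2) subgraph_trans[OF H(1) sub(1)] unfolding max_subgraph_def by metis
      with sub(1) H(1) show "H = C"
        unfolding subgraph_def compatible_def by (intro pre_digraph.equality) auto
    qed
    with C sc_conn show "max_subgraph ?conn C"
      unfolding max_subgraph_def by blast
  qed
  then show ?thesis by (simp add: graph_component_def sccs_altdef2)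
qed

text \<open>\<open>D v\<close> is the event that \<open>v\<close> is deleted.\<close>

definition vertex_deletion :: "real \<Rightarrow> ('a, 'b) pre_digraph \<Rightarrow> ('a, 'b) pre_digraph pmf" where
  "vertex_deletion p G =
     map_pmf (\<lambda>D. G \<restriction> {v \<in> verts G. \<not> D v}) (Pi_pmf (verts G) False (\<lambda>_. bernoulli_pmf p))"

text \<open>
  The minimum \<open>K\<close>. The set minimised over may be empty for small \<open>n\<close>, in which case the value is
  unspecified; if \<open>f\<close> is bounded below by a positive constant, it is nonempty for large \<open>n\<close>.
\<close>

definition comp_threshold :: "real \<Rightarrow> nat \<Rightarrow> (nat \<Rightarrow> real) \<Rightarrow> nat" where
  "comp_threshold \<alpha> n f =
     (LEAST u. u \<in> {1..n div 2} \<and> (\<forall>k\<in>{u..n div 2}. real k * f k > 1 / \<alpha>))"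

end

theory Submission
  imports Defs
begin

text \<open>
  Call a set of vertices connected if it induces a connected subgraph. Closed walks around spanning
  trees show that a graph on \<open>n\<close> vertices with degrees at most \<open>d\<close> has at most \<open>n * d ^ (2 * k)\<close>
  connected sets of size \<open>k\<close> (\<open>card_conn_sets_le\<close>), so the probability that one of them loses
  at least \<open>t\<close> of its neighbours is at most \<open>n * Q ^ k * p powr t\<close> with
  \<open>Q = d\<^sup>2 * 2 ^ d\<close> (\<open>prob_conn_set_many_deleted\<close>). Let \<open>K\<close> be \<open>6 / (\<alpha> * c)\<close>
  rounded up. For \<open>p = n powr (- \<alpha>)\<close>, with high probability

  \<^item> no connected set of size at most \<open>K\<close> loses more than \<open>1 / \<alpha>\<close> neighbours,
  \<^item> no connected set of size \<open>k > K\<close> loses \<open>c * k / 2\<close> or more neighbours, and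
  \<^item> fewer than \<open>n powr (1 - \<alpha> / 2)\<close> vertices are deleted.

  The rest is deterministic. All neighbours of a component of the surviving graph are deleted, and a
  connected set of size \<open>k \<le> n / 2\<close> has at least \<open>c * k\<close> neighbours. By the second property every
  component has at most \<open>K\<close> or more than \<open>n / 2\<close> vertices, and by the first property one of size
  \<open>k \<le> K\<close> satisfies \<open>k * f k \<le> 1 / \<alpha>\<close> and so lies below the threshold. Every small component
  touches a deleted vertex, and a deleted vertex touches at most \<open>d\<close> of them, so by the third property
  small components and deleted vertices make up only \<open>o(n)\<close> vertices. What remains is a single giant
  component (\<open>giant_exists\<close>).

  A connected subset of the giant component with more than \<open>K\<close> vertices expands by a factor \<open>c / 2\<close>,
  by the second property; a smaller one has at least one neighbour, hence expands by \<open>1 / K\<close>. For an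
  arbitrary subset, add up over the components that it induces; a vertex is counted at most \<open>d\<close> times
  (\<open>subset_expands\<close>). This gives the expansion constant \<open>min (1 / K) (c / 2) / d\<close>.
\<close>

section \<open>Connected sets and components of a relation\<close>

text \<open>
  Expansion, connectedness and components depend only on the edge relation, and deleting vertices
  amounts to restricting it. Working with the relation \<open>E\<close> keeps all sets of vertices inside one
  fixed structure instead of one digraph for each induced subgraph.
\<close>

definition ext_nbhd :: "('a \<times> 'a) set \<Rightarrow> 'a set \<Rightarrow> 'a set" where
  "ext_nbhd E U = E `` U - U"

definition conn_set :: "('a \<times> 'a) set \<Rightarrow> 'a set \<Rightarrow> bool" where
  "conn_set E U \<longleftrightarrow> U \<noteq> {} \<and> (\<forall>x\<in>U. \<forall>y\<in>U. (x, y) \<in> (Restr E U)\<^sup>*)"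

definition comp_of :: "('a \<times> 'a) set \<Rightarrow> 'a set \<Rightarrow> 'a \<Rightarrow> 'a set" where
  "comp_of E S u = (Restr E S)\<^sup>* `` {u}"

lemma comp_of_self: "u \<in> comp_of E S u"
  by (simp add: comp_of_def)

lemma comp_of_subset: "u \<in> S \<Longrightarrow> comp_of E S u \<subseteq> S"
  by (auto simp: comp_of_def elim: rtranclE)

lemma comp_of_closed: "x \<in> comp_of E S u \<Longrightarrow> x \<in> S \<Longrightarrow> y \<in> S \<Longrightarrow> (x, y) \<in> E \<Longrightarrow> y \<in> comp_of E S u"
  unfolding comp_of_def by (auto intro: rtrancl_into_rtrancl)

lemma ext_nbhd_comp_of: "u \<in> S \<Longrightarrow> ext_nbhd E (comp_of E S u) \<inter> S = {}"
  using comp_of_closed[of _ E S u] comp_of_subset[of u S E] unfolding ext_nbhd_def by blast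

lemma sym_Restr_rtrancl: "sym E \<Longrightarrow> sym ((Restr E S)\<^sup>*)"
  by (intro sym_rtrancl sym_Int) (auto simp: sym_def)

lemma comp_of_eq:
  assumes "sym E" "v \<in> comp_of E S u"
  shows "comp_of E S v = comp_of E S u"
  using assms sym_Restr_rtrancl[OF assms(1), of S] unfolding comp_of_def
  by (auto dest: symD intro: rtrancl_trans)

lemma conn_set_comp_of:
  assumes "sym E"
  shows "conn_set E (comp_of E S u)"
proof -
  let ?C = "comp_of E S u"
  have from_u: "(u, y) \<in> (Restr E ?C)\<^sup>*" if "y \<in> ?C" for y
  proof -
    have "(u, y) \<in> (Restr E S)\<^sup>*" using that by (simp add: comp_of_def)
    then show ?thesis
    proof (induction rule: rtrancl_induct)
      case (step y z)
      then have "y \<in> ?C" "z \<in> ?C"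
        unfolding comp_of_def by (auto intro: rtrancl_into_rtrancl)
      then show ?case using step by (auto intro: rtrancl_into_rtrancl)
    qed simp
  qed
  have "(x, y) \<in> (Restr E ?C)\<^sup>*" if "x \<in> ?C" "y \<in> ?C" for x y
    using symD[OF sym_Restr_rtrancl[OF assms] from_u[OF that(1)]] from_u[OF that(2)]
    by (rule rtrancl_trans)
  then show ?thesis using comp_of_self[of u E S] unfolding conn_set_def by blast
qed

lemma conn_set_exit_edge:
  assumes "conn_set E U" "A \<subseteq> U" "A \<noteq> {}" "A \<noteq> U"
  obtains a b where "a \<in> A" "b \<in> U - A" "(a, b) \<in> E"
proof -
  obtain x y where xy: "x \<in> A" "y \<in> U - A" using assms by blast
  then have "(x, y) \<in> (Restr E U)\<^sup>*" using assms unfolding conn_set_def by blast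
  then have "y \<in> A \<or> (\<exists>a\<in>A. \<exists>b\<in>U - A. (a, b) \<in> E)"
    by (induction rule: rtrancl_induct) (use xy in auto)
  then show ?thesis using xy that by blast
qed

text \<open>
  A closed walk around a spanning tree traverses each edge twice. Such a walk is grown one vertex at
  a time: a new vertex \<open>b\<close> with a neighbour \<open>a\<close> on the walk is visited by the detour \<open>a, b, a\<close>.
\<close>

lemma conn_set_covering_walk:
  assumes "sym E" "finite U" "conn_set E U"
  obtains w where "successively (\<lambda>x y. (x, y) \<in> E) w" "length w = Suc (2 * (card U - 1))" "set w = U"
proof -
  have "\<exists>w. successively (\<lambda>x y. (x, y) \<in> E) w \<and> length w = Suc (2 * n) \<and> set w \<subseteq> U \<and> card (set w) = Suc n"
    if "Suc n \<le> card U" for n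
    using that
  proof (induction n)
    case 0
    obtain x where "x \<in> U" using assms unfolding conn_set_def by blast
    then show ?case by (intro exI[of _ "[x]"]) simp
  next
    case (Suc n)
    then obtain w where w: "successively (\<lambda>x y. (x, y) \<in> E) w" "length w = Suc (2 * n)"
      "set w \<subseteq> U" "card (set w) = Suc n" by auto
    have "set w \<noteq> {}" "set w \<noteq> U" using w Suc.prems by auto
    then obtain a b where ab: "a \<in> set w" "b \<in> U - set w" "(a, b) \<in> E"
      using conn_set_exit_edge[OF assms(3) w(3)] by blast
    obtain xs ys where sp: "w = xs @ a # ys" using ab(1) by (meson split_list)
    have "(b, a) \<in> E" using ab assms by (auto dest: symD)
    then have "successively (\<lambda>x y. (x, y) \<in> E) (xs @ a # b # a # ys)"
      using w(1) ab(3) unfolding sp by (auto simp: successively_append_iff successively_Cons)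
    moreover have "set (xs @ a # b # a # ys) = insert b (set w)" by (auto simp: sp)
    ultimately show ?case using w ab
      by (intro exI[of _ "xs @ a # b # a # ys"]) (auto simp: sp)
  qed
  moreover have "card U > 0" using assms by (auto simp: conn_set_def card_gt_0_iff)
  ultimately obtain w where "successively (\<lambda>x y. (x, y) \<in> E) w" "length w = Suc (2 * (card U - 1))"
     "set w \<subseteq> U" "card (set w) = card U"
    by (metis Suc_pred' order_refl diff_Suc_1)
  then show ?thesis using that assms(2) card_subset_eq by metis
qed

section \<open>Counting connected sets\<close>

locale bounded_degree =
  fixes V :: "'a set" and E :: "('a \<times> 'a) set" and d :: nat
  assumes finite_V [simp]: "finite V"
    and E_subset: "E \<subseteq> V \<times> V"
    and sym_E: "sym E"
    and degree: "card (E `` {v}) \<le> d"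
    and d_pos: "1 \<le> d"
begin

lemma finite_Image [simp]: "finite (E `` U)"
  by (rule finite_subset[OF _ finite_V]) (use E_subset in auto)

lemma ext_nbhd_subset: "ext_nbhd E U \<subseteq> V"
  using E_subset unfolding ext_nbhd_def by auto

lemma finite_ext_nbhd [simp]: "finite (ext_nbhd E U)"
  by (simp add: ext_nbhd_def)

lemma card_ext_nbhd_le:
  assumes "finite U"
  shows "card (ext_nbhd E U) \<le> d * card U"
proof -
  have "card (ext_nbhd E U) \<le> card (\<Union>u\<in>U. E `` {u})"
    by (rule card_mono) (use assms in \<open>auto simp: ext_nbhd_def\<close>)
  also have "\<dots> \<le> (\<Sum>u\<in>U. card (E `` {u}))" by (rule card_UN_le[OF assms])
  also have "\<dots> \<le> of_nat (card U) * d" by (rule sum_bounded_above) (rule degree)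
  finally show ?thesis by (simp add: mult.commute)
qed

text \<open>
  Finiteness is part of the induction because the step bounds the cardinality of a union over the
  walks of the previous length.
\<close>

lemma card_walks_le:
  "finite {w. successively (\<lambda>x y. (x, y) \<in> E) w \<and> length w = Suc n \<and> set w \<subseteq> V} \<and>
   card {w. successively (\<lambda>x y. (x, y) \<in> E) w \<and> length w = Suc n \<and> set w \<subseteq> V} \<le> card V * d ^ n"
proof (induction n)
  case 0
  have "{w. successively (\<lambda>x y. (x, y) \<in> E) w \<and> length w = Suc 0 \<and> set w \<subseteq> V} = (\<lambda>x. [x]) ` V"
    by (auto simp: length_Suc_conv)
  then show ?case by (simp add: card_image_le)
next
  case (Suc n)
  let ?W = "\<lambda>n. {w. successively (\<lambda>x y. (x, y) \<in> E) w \<and> length w = Suc n \<and> set w \<subseteq> V}"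
  have sub: "?W (Suc n) \<subseteq> (\<Union>w\<in>?W n. (\<lambda>y. y # w) ` (E `` {hd w}))"
  proof
    fix w assume "w \<in> ?W (Suc n)"
    then obtain y w' where w: "w = y # w'" "w' \<in> ?W n" "(y, hd w') \<in> E"
      by (auto simp: length_Suc_conv successively_Cons)
    then show "w \<in> (\<Union>w\<in>?W n. (\<lambda>y. y # w) ` (E `` {hd w}))"
      using symD[OF sym_E w(3)] by blast
  qed
  have fin: "finite (\<Union>w\<in>?W n. (\<lambda>y. y # w) ` (E `` {hd w}))"
    using Suc by (intro finite_UN_I) auto
  have "card (?W (Suc n)) \<le> card (\<Union>w\<in>?W n. (\<lambda>y. y # w) ` (E `` {hd w}))"
    by (rule card_mono[OF fin sub])
  also have "\<dots> \<le> (\<Sum>w\<in>?W n. card ((\<lambda>y. y # w) ` (E `` {hd w})))"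
    by (rule card_UN_le) (use Suc in auto)
  also have "\<dots> \<le> of_nat (card (?W n)) * d"
    by (rule sum_bounded_above) (auto intro: order_trans[OF card_image_le degree])
  also have "\<dots> \<le> card V * d ^ n * d" using Suc by simp
  finally show ?case using finite_subset[OF sub fin] by (simp add: mult_ac)
qed

text \<open>
  A connected set is the vertex set of its covering walk, so it suffices to count walks. The point is
  that the bound is exponential in \<open>k\<close>; adding the vertices one at a time in all
  possible ways would give a factorial.
\<close>

lemma card_conn_sets_le:
  "card {U. U \<subseteq> V \<and> conn_set E U \<and> card U = k} \<le> card V * d ^ (2 * k)"
proof (cases "k = 0")
  case True
  then have "{U. U \<subseteq> V \<and> conn_set E U \<and> card U = k} = {}"
    by (auto simp: conn_set_def card_eq_0_iff dest: finite_subset[OF _ finite_V])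
  then show ?thesis by (simp only: card.empty)
next
  case False
  let ?W = "{w. successively (\<lambda>x y. (x, y) \<in> E) w \<and> length w = Suc (2 * (k - 1)) \<and> set w \<subseteq> V}"
  have "{U. U \<subseteq> V \<and> conn_set E U \<and> card U = k} \<subseteq> set ` ?W"
  proof
    fix U assume U: "U \<in> {U. U \<subseteq> V \<and> conn_set E U \<and> card U = k}"
    then have "finite U" "conn_set E U" by (auto dest: finite_subset[OF _ finite_V])
    from conn_set_covering_walk[OF sym_E this] U show "U \<in> set ` ?W" by (smt (verit) image_iff mem_Collect_eq)
  qed
  then have "card {U. U \<subseteq> V \<and> conn_set E U \<and> card U = k} \<le> card ?W"
    using card_walks_le[of "2 * (k - 1)"] by (meson card_image_le card_mono finite_imageI order_trans)
  also have "\<dots> \<le> card V * d ^ (2 * (k - 1))" using card_walks_le by blast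
  also have "\<dots> \<le> card V * d ^ (2 * k)"
    using d_pos by (intro mult_left_mono power_increasing) auto
  finally show ?thesis .
qed

section \<open>Probability that many neighbours are deleted\<close>

text \<open>
  Union bound over the subsets \<open>S\<close> of \<open>N\<close> with at least \<open>t\<close> elements, each of which is deleted
  entirely with probability \<open>p ^ card S\<close>.
\<close>

lemma prob_many_deleted:
  assumes "N \<subseteq> V" "0 < p" "p \<le> 1"
  shows "measure_pmf.prob (Pi_pmf V False (\<lambda>_. bernoulli_pmf p)) {D. t \<le> real (card {v \<in> N. D v})}
    \<le> 2 ^ card N * p powr t"
proof -
  let ?M = "Pi_pmf V False (\<lambda>_. bernoulli_pmf p)"
  have finN: "finite N" using assms finite_subset finite_V by blast
  have all: "measure_pmf.prob ?M {D. \<forall>v\<in>S. D v} = p ^ card S" if "S \<subseteq> V" for S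
  proof -
    have "{D. \<forall>v\<in>S. D v} = Pi S (\<lambda>_. {True})" by auto
    also have "\<dots> = Pi V (\<lambda>v. if v \<in> S then {True} else UNIV)"
      using that by (auto simp: Pi_def)
    finally have "measure_pmf.prob ?M {D. \<forall>v\<in>S. D v} =
        (\<Prod>v\<in>V. measure_pmf.prob (bernoulli_pmf p) (if v \<in> S then {True} else UNIV))"
      by (simp add: measure_Pi_pmf_Pi)
    also have "\<dots> = (\<Prod>v\<in>V. if v \<in> S then p else 1)"
      using assms by (intro prod.cong) (auto simp: measure_pmf_single)
    also have "\<dots> = p ^ card S"
      using that by (simp add: prod.If_cases Int_absorb1)
    finally show ?thesis .
  qed
  let ?S = "{S \<in> Pow N. t \<le> real (card S)}"
  have "measure_pmf.prob ?M {D. t \<le> real (card {v \<in> N. D v})}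
      \<le> measure_pmf.prob ?M (\<Union>S\<in>?S. {D. \<forall>v\<in>S. D v})"
  proof (rule measure_pmf.finite_measure_mono)
    show "{D. t \<le> real (card {v \<in> N. D v})} \<subseteq> (\<Union>S\<in>?S. {D. \<forall>v\<in>S. D v})"
    proof
      fix D assume "D \<in> {D. t \<le> real (card {v \<in> N. D v})}"
      then have "{v \<in> N. D v} \<in> ?S" "D \<in> {D'. \<forall>v\<in>{v \<in> N. D v}. D' v}" by auto
      then show "D \<in> (\<Union>S\<in>?S. {D. \<forall>v\<in>S. D v})" by blast
    qed
  qed simp
  also have "\<dots> \<le> (\<Sum>S\<in>?S. measure_pmf.prob ?M {D. \<forall>v\<in>S. D v})"
    by (rule measure_UNION_le) (use finN in auto)
  also have "\<dots> \<le> (\<Sum>S\<in>?S. p powr t)"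
  proof (rule sum_mono)
    fix S assume S: "S \<in> ?S"
    then have "measure_pmf.prob ?M {D. \<forall>v\<in>S. D v} = p ^ card S"
      using assms by (intro all) auto
    also have "\<dots> = p powr card S" using assms by (simp add: powr_realpow)
    also have "\<dots> \<le> p powr t" using S assms by (intro powr_mono') auto
    finally show "measure_pmf.prob ?M {D. \<forall>v\<in>S. D v} \<le> p powr t" .
  qed
  also have "\<dots> = card ?S * p powr t" by simp
  also have "\<dots> \<le> 2 ^ card N * p powr t"
  proof (rule mult_right_mono)
    have "card ?S \<le> card (Pow N)" using finN by (intro card_mono) auto
    then show "real (card ?S) \<le> 2 ^ card N" using finN of_nat_mono[where 'a = real] by (fastforce simp: card_Pow)
  qed simp
  finally show ?thesis .
qed

text \<open>
  Union bound over connected sets: the factor \<open>d\<^sup>2\<close> per vertex counts the sets, and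
  \<open>2 ^ d\<close> per vertex counts the subsets of the at most \<open>d * k\<close> neighbours.
\<close>

lemma prob_conn_set_many_deleted:
  assumes "0 < p" "p \<le> 1"
  shows "measure_pmf.prob (Pi_pmf V False (\<lambda>_. bernoulli_pmf p))
      {D. \<exists>U\<subseteq>V. conn_set E U \<and> card U = k \<and> t \<le> real (card {v \<in> ext_nbhd E U. D v})}
    \<le> real (card V) * (real d ^ 2 * 2 ^ d) ^ k * p powr t"
proof -
  let ?M = "Pi_pmf V False (\<lambda>_. bernoulli_pmf p)"
  let ?U = "{U. U \<subseteq> V \<and> conn_set E U \<and> card U = k}"
  have finU: "finite ?U" by (rule finite_subset[of _ "Pow V"]) auto
  have "measure_pmf.prob ?M {D. \<exists>U\<subseteq>V. conn_set E U \<and> card U = k \<and> t \<le> real (card {v \<in> ext_nbhd E U. D v})}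
     \<le> measure_pmf.prob ?M (\<Union>U\<in>?U. {D. t \<le> real (card {v \<in> ext_nbhd E U. D v})})"
    by (rule measure_pmf.finite_measure_mono) auto
  also have "\<dots> \<le> (\<Sum>U\<in>?U. measure_pmf.prob ?M {D. t \<le> real (card {v \<in> ext_nbhd E U. D v})})"
    by (rule measure_UNION_le) (use finU in auto)
  also have "\<dots> \<le> (\<Sum>U\<in>?U. 2 ^ (d * k) * p powr t)"
  proof (rule sum_mono)
    fix U assume U: "U \<in> ?U"
    have "measure_pmf.prob ?M {D. t \<le> real (card {v \<in> ext_nbhd E U. D v})} \<le> 2 ^ card (ext_nbhd E U) * p powr t"
      by (rule prob_many_deleted[OF ext_nbhd_subset assms])
    also have "\<dots> \<le> 2 ^ (d * k) * p powr t"
      using card_ext_nbhd_le[of U] U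
      by (intro mult_right_mono power_increasing) (auto dest: finite_subset[OF _ finite_V])
    finally show "measure_pmf.prob ?M {D. t \<le> real (card {v \<in> ext_nbhd E U. D v})} \<le> 2 ^ (d * k) * p powr t" .
  qed
  also have "\<dots> = card ?U * (2 ^ (d * k) * p powr t)" by simp
  also have "\<dots> \<le> real (card V * d ^ (2 * k)) * (2 ^ (d * k) * p powr t)"
    using card_conn_sets_le[of k] by (intro mult_right_mono of_nat_mono) auto
  also have "\<dots> = real (card V) * (real d ^ 2 * 2 ^ d) ^ k * p powr t"
    by (simp add: power_mult_distrib power_mult)
  finally show ?thesis .
qed

text \<open>
  For \<open>N = V\<close> the factor \<open>2 ^ card V\<close> of the previous bounds would be useless, whereas the mean
  number of deleted vertices is all that is needed.
\<close>

lemma prob_many_deleted_Markov: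
  assumes "0 \<le> p" "p \<le> 1" "0 < t"
  shows "measure_pmf.prob (Pi_pmf V False (\<lambda>_. bernoulli_pmf p)) {D. t \<le> real (card {v \<in> V. D v})}
    \<le> real (card V) * p / t"
proof -
  let ?M = "Pi_pmf V False (\<lambda>_. bernoulli_pmf p)"
  let ?X = "\<lambda>D. \<Sum>v\<in>V. (of_bool (D v) :: real)"
  have int: "integrable ?M (\<lambda>D. of_bool (D v) :: real)" for v
    by (rule measure_pmf.integrable_const_bound[of _ 1]) auto
  have E1: "measure_pmf.expectation ?M (\<lambda>D. of_bool (D v) :: real) = p" if "v \<in> V" for v
  proof -
    have "measure_pmf.expectation ?M (\<lambda>D. of_bool (D v) :: real) =
        measure_pmf.expectation (map_pmf (\<lambda>D. D v) ?M) of_bool" by simp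
    then show ?thesis using that assms by (subst (asm) Pi_pmf_component) auto
  qed
  have X: "?X D = real (card {v \<in> V. D v})" for D
    by (simp add: sum.If_cases of_bool_def Int_def)
  have "measure_pmf.prob ?M {D \<in> space ?M. t \<le> ?X D} \<le> measure_pmf.expectation ?M ?X / t"
    by (rule integral_Markov_inequality_measure[where A = "{}"]) (use assms in \<open>auto intro!: sum_nonneg Bochner_Integration.integrable_sum int simp del: sum_of_bool_eq\<close>)
  also have "measure_pmf.expectation ?M ?X = (\<Sum>v\<in>V. p)"
    by (subst Bochner_Integration.integral_sum) (use int E1 in auto)
  finally show ?thesis unfolding X by simp
qed

end

section \<open>Survivors of a sparse deletion\<close>

text \<open>
  The properties of the random deleted set \<open>D\<close> under which the survivors contain an expanding giant
  component: connected sets larger than \<open>K\<close> keep more than half of the neighbours that expansion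
  guarantees them, and \<open>D\<close> is too small for the components of size at most \<open>K\<close>
  that it cuts off to fill the graph.
\<close>

locale sparse_deletion = bounded_degree V E d
  for V :: "'a set" and E and d +
  fixes D :: "'a set" and c :: real and K :: nat
  assumes D_subset: "D \<subseteq> V"
    and c_pos: "0 < c"
    and K_pos: "1 \<le> K"
    and K_le: "2 * K \<le> card V"
    and expansion: "\<lbrakk>U \<subseteq> V; U \<noteq> {}; 2 * card U \<le> card V\<rbrakk> \<Longrightarrow> c * card U \<le> card (ext_nbhd E U)"
    and half_survives: "\<lbrakk>U \<subseteq> V; conn_set E U; K < card U; 2 * card U \<le> card V\<rbrakk>
           \<Longrightarrow> card (ext_nbhd E U \<inter> D) < c / 2 * card U"
    and few_deleted: "card D * (1 + d * K) < card V"
begin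

abbreviation comp :: "'a \<Rightarrow> 'a set" where
  "comp \<equiv> comp_of E (V - D)"

lemma finite_D [simp]: "finite D"
  using D_subset finite_V finite_subset by blast

lemma comp_nonempty: "comp u \<noteq> {}"
  using comp_of_self[of u E "V - D"] by blast

lemma comp_subset: "u \<in> V - D \<Longrightarrow> comp u \<subseteq> V - D"
  by (rule comp_of_subset)

lemma finite_comp: "u \<in> V - D \<Longrightarrow> finite (comp u)"
  using comp_subset finite_V by (meson Diff_subset finite_subset)

lemma ext_nbhd_comp_subset: "u \<in> V - D \<Longrightarrow> ext_nbhd E (comp u) \<subseteq> D"
  using ext_nbhd_comp_of[of u "V - D" E] ext_nbhd_subset by blast

text \<open>
  All neighbours of a component are deleted. A component of intermediate size would have at least
  \<open>c\<close> times as many neighbours as vertices, fewer than half of which may be deleted.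
\<close>

lemma comp_small_or_giant:
  assumes "u \<in> V - D"
  shows "card (comp u) \<le> K \<or> card V < 2 * card (comp u)"
proof (rule ccontr)
  assume "\<not> ?thesis"
  then have sz: "K < card (comp u)" "2 * card (comp u) \<le> card V" by auto
  have sub: "comp u \<subseteq> V" using comp_subset[OF assms] by blast
  have "c * card (comp u) \<le> card (ext_nbhd E (comp u))"
    by (rule expansion[OF sub _ sz(2)]) (rule comp_nonempty)
  also have "ext_nbhd E (comp u) = ext_nbhd E (comp u) \<inter> D"
    using ext_nbhd_comp_subset[OF assms] by blast
  finally have "c * card (comp u) < c / 2 * card (comp u)"
    using half_survives[OF sub conn_set_comp_of[OF sym_E] sz] by linarith
  moreover have "c / 2 * card (comp u) \<le> c * card (comp u)"
    using c_pos by (intro mult_right_mono) auto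
  ultimately show False by simp
qed

lemma giant_unique:
  assumes "u \<in> V - D" "v \<in> V - D" "card V < 2 * card (comp u)" "card V < 2 * card (comp v)"
  shows "comp u = comp v"
proof -
  have "comp u \<inter> comp v \<noteq> {}"
  proof
    assume dis: "comp u \<inter> comp v = {}"
    have "card (comp u) + card (comp v) = card (comp u \<union> comp v)"
      using assms dis by (intro card_Un_disjoint[symmetric] finite_comp) auto
    also have "\<dots> \<le> card V" using comp_subset assms by (intro card_mono) auto
    finally show False using assms by linarith
  qed
  then show ?thesis using comp_of_eq[OF sym_E] by blast
qed

text \<open>
  By expansion, a small component is adjacent to some deleted vertex. A deleted vertex is adjacent to
  at most \<open>d\<close> components, so all small components together are controlled by the size of \<open>D\<close>.
\<close>

lemma card_small_comps_le:
  "card {u \<in> V - D. card (comp u) \<le> K} \<le> card D * (d * K)"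
proof -
  let ?T = "\<lambda>x. {y \<in> E `` {x}. y \<in> V - D \<and> card (comp y) \<le> K}"
  have T: "card (?T x) \<le> d" for x
    by (rule order_trans[OF card_mono degree]) auto
  have sub: "{u \<in> V - D. card (comp u) \<le> K} \<subseteq> (\<Union>x\<in>D. \<Union>y\<in>?T x. comp y)"
  proof
    fix u assume u: "u \<in> {u \<in> V - D. card (comp u) \<le> K}"
    then have uV: "u \<in> V - D" by simp
    have "c * card (comp u) \<le> card (ext_nbhd E (comp u))"
      using u K_le comp_subset[OF uV] comp_nonempty by (intro expansion) auto
    moreover have "0 < c * card (comp u)"
      using c_pos finite_comp[OF uV] comp_nonempty[of u] by (simp add: card_gt_0_iff)
    ultimately have "ext_nbhd E (comp u) \<noteq> {}" by auto
    then obtain x y where xy: "x \<in> D" "y \<in> comp u" "(y, x) \<in> E"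
      using ext_nbhd_comp_subset[OF uV] unfolding ext_nbhd_def by blast
    have "comp y = comp u" by (rule comp_of_eq[OF sym_E xy(2)])
    moreover have "y \<in> V - D" using comp_subset[OF uV] xy by blast
    moreover have "(x, y) \<in> E" using xy sym_E by (auto dest: symD)
    ultimately have "y \<in> ?T x" "u \<in> comp y" using u comp_of_self[of u E "V - D"] by auto
    then show "u \<in> (\<Union>x\<in>D. \<Union>y\<in>?T x. comp y)" using xy(1) by blast
  qed
  have fin: "finite (?T x)" for x by (rule finite_subset[of _ "E `` {x}"]) auto
  have "card {u \<in> V - D. card (comp u) \<le> K} \<le> card (\<Union>x\<in>D. \<Union>y\<in>?T x. comp y)"
    by (rule card_mono[OF _ sub]) (use finite_comp fin in auto)
  also have "\<dots> \<le> (\<Sum>x\<in>D. card (\<Union>y\<in>?T x. comp y))" by (rule card_UN_le) simp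
  also have "\<dots> \<le> (\<Sum>x\<in>D. d * K)"
  proof (rule sum_mono)
    fix x
    have "card (\<Union>y\<in>?T x. comp y) \<le> (\<Sum>y\<in>?T x. card (comp y))"
      by (rule card_UN_le[OF fin])
    also have "\<dots> \<le> of_nat (card (?T x)) * K" by (rule sum_bounded_above) auto
    also have "\<dots> \<le> d * K" using T by simp
    finally show "card (\<Union>y\<in>?T x. comp y) \<le> d * K" .
  qed
  finally show ?thesis by simp
qed

lemma giant_exists:
  obtains u where "u \<in> V - D" "card V < 2 * card (comp u)"
    "card V \<le> card (comp u) + card D * (1 + d * K)"
proof -
  let ?M = "{u \<in> V - D. card (comp u) \<le> K}"
  have "card V \<le> card (V - D - ?M) + card (D \<union> ?M)"
    by (rule order_trans[OF card_mono card_Un_le]) auto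
  also have "card (D \<union> ?M) \<le> card D + card D * (d * K)"
    using card_small_comps_le card_Un_le[of D ?M] by linarith
  finally have *: "card V \<le> card (V - D - ?M) + card D * (1 + d * K)" by simp
  with few_deleted have "card (V - D - ?M) \<noteq> 0" by linarith
  then have "V - D - ?M \<noteq> {}" by (metis card.empty)
  then obtain u where u: "u \<in> V - D - ?M" by blast
  then have ubig: "u \<in> V - D" "card V < 2 * card (comp u)" using comp_small_or_giant by auto
  have "V - D - ?M \<subseteq> comp u"
  proof
    fix v assume v: "v \<in> V - D - ?M"
    then have "v \<in> V - D" "card V < 2 * card (comp v)" using comp_small_or_giant by auto
    then have "comp u = comp v" using giant_unique ubig by blast
    then show "v \<in> comp u" using comp_of_self[of v E "V - D"] by simp
  qed
  then have "card (V - D - ?M) \<le> card (comp u)" by (rule card_mono[OF finite_comp[OF ubig(1)]])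
  then show ?thesis using that ubig * by simp
qed

text \<open>
  A large connected set retains half of its guaranteed neighbours, and these lie in the same
  component. A small one needs only a single neighbour, which it has because the component is
  connected and not exhausted by it.
\<close>

lemma conn_subset_expands:
  assumes u: "u \<in> V - D" and W: "W \<subseteq> comp u" "conn_set E W" "2 * card W \<le> card (comp u)"
  shows "min (1 / K) (c / 2) * card W \<le> card (ext_nbhd E W \<inter> comp u)"
proof -
  have finW: "finite W" using W finite_comp[OF u] finite_subset by blast
  have "W \<noteq> {}" using W by (simp add: conn_set_def)
  have WV: "W \<subseteq> V" using W comp_subset[OF u] by blast
  have "card (comp u) \<le> card V" using comp_subset[OF u] by (intro card_mono) auto
  then have half: "2 * card W \<le> card V" using W by linarith
  show ?thesis
  proof (cases "K < card W")
    case True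
    have "ext_nbhd E W - D \<subseteq> ext_nbhd E W \<inter> comp u"
      using W(1) comp_of_closed[of _ E "V - D" u] comp_subset[OF u] ext_nbhd_subset[of W]
      unfolding ext_nbhd_def by blast
    then have "card (ext_nbhd E W - D) \<le> card (ext_nbhd E W \<inter> comp u)"
      by (rule card_mono[rotated]) simp
    moreover have "card (ext_nbhd E W) = card (ext_nbhd E W - D) + card (ext_nbhd E W \<inter> D)"
      by (subst card_Un_disjoint[symmetric]) (auto intro!: arg_cong[where f = card])
    moreover have "c * card W \<le> card (ext_nbhd E W)"
      by (rule expansion[OF WV \<open>W \<noteq> {}\<close> half])
    moreover have "card (ext_nbhd E W \<inter> D) < c / 2 * card W"
      by (rule half_survives[OF WV W(2) True half])
    ultimately have "c / 2 * card W \<le> card (ext_nbhd E W \<inter> comp u)" by simp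
    moreover have "min (1 / K) (c / 2) * card W \<le> c / 2 * card W"
      by (intro mult_right_mono) auto
    ultimately show ?thesis by linarith
  next
    case False
    have "card W \<noteq> 0" using finW \<open>W \<noteq> {}\<close> by simp
    then have "W \<noteq> comp u" using W(3) by auto
    then obtain a b where ab: "a \<in> W" "b \<in> comp u - W" "(a, b) \<in> E"
      using conn_set_exit_edge[OF conn_set_comp_of[OF sym_E] W(1) \<open>W \<noteq> {}\<close>] by blast
    then have "ext_nbhd E W \<inter> comp u \<noteq> {}" unfolding ext_nbhd_def by blast
    then have "card (ext_nbhd E W \<inter> comp u) \<ge> 1" by (simp add: Suc_le_eq card_gt_0_iff)
    moreover have "min (1 / K) (c / 2) * card W \<le> 1 / K * card W"
      by (intro mult_right_mono) auto
    moreover have "1 / K * card W \<le> 1" using False K_pos by simp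
    ultimately show ?thesis by linarith
  qed
qed

text \<open>
  An arbitrary set \<open>U\<close> is split into the components of the graph that it induces. Their
  neighbourhoods are disjoint from \<open>U\<close>, and a vertex lies in at most \<open>d\<close> of them, because it has
  at most \<open>d\<close> neighbours. Double counting thus transfers expansion from connected sets to all sets at
  the cost of a factor \<open>d\<close>.
\<close>

lemma subset_expands:
  assumes u: "u \<in> V - D" and U: "U \<subseteq> comp u" "2 * card U \<le> card (comp u)"
  shows "min (1 / K) (c / 2) / d * card U \<le> card (ext_nbhd E U \<inter> comp u)"
proof -
  let ?\<beta> = "min (1 / K) (c / 2)" and ?N = "ext_nbhd E U \<inter> comp u" and ?P = "comp_of E U ` U"
  have finU: "finite U" using U finite_comp[OF u] finite_subset by blast
  have finN: "finite ?N" by simp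
  have P_sub: "W \<subseteq> U" if "W \<in> ?P" for W using that comp_of_subset[of _ U E] by blast
  have U_le: "card U \<le> (\<Sum>W\<in>?P. card W)"
  proof -
    have "U = \<Union>?P" using P_sub comp_of_self[of _ E U] by blast
    then have "card U = card (\<Union>W\<in>?P. W)" by simp
    also have "\<dots> \<le> (\<Sum>W\<in>?P. card W)" by (rule card_UN_le) (use finU in auto)
    finally show ?thesis .
  qed
  have part: "?\<beta> * card W \<le> card {v \<in> ?N. v \<in> E `` W}" if "W \<in> ?P" for W
  proof -
    have "card W \<le> card U" by (rule card_mono[OF finU P_sub[OF that]])
    then have "?\<beta> * card W \<le> card (ext_nbhd E W \<inter> comp u)"
      using that U P_sub[OF that] conn_set_comp_of[OF sym_E, of U]
      by (intro conn_subset_expands[OF u]) auto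
    also have "ext_nbhd E W \<inter> comp u \<subseteq> {v \<in> ?N. v \<in> E `` W}"
      using that P_sub[OF that] ext_nbhd_comp_of[of _ U E] unfolding ext_nbhd_def by blast
    then have "card (ext_nbhd E W \<inter> comp u) \<le> card {v \<in> ?N. v \<in> E `` W}"
      by (rule card_mono[rotated]) simp
    finally show ?thesis by simp
  qed
  \<comment> \<open>A component of \<open>U\<close> next to \<open>v\<close> is determined by any neighbour of \<open>v\<close> in it.\<close>
  have touched: "card {W \<in> ?P. v \<in> E `` W} \<le> d" for v
  proof -
    have "{W \<in> ?P. v \<in> E `` W} \<subseteq> comp_of E U ` (E `` {v})"
    proof
      fix W assume "W \<in> {W \<in> ?P. v \<in> E `` W}"
      then obtain x w where x: "W = comp_of E U x" "w \<in> W" "(w, v) \<in> E" by auto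
      then have "W = comp_of E U w" using comp_of_eq[OF sym_E] by metis
      moreover have "(v, w) \<in> E" using x sym_E by (auto dest: symD)
      ultimately show "W \<in> comp_of E U ` (E `` {v})" by blast
    qed
    then have "card {W \<in> ?P. v \<in> E `` W} \<le> card (comp_of E U ` (E `` {v}))"
      by (rule card_mono[rotated]) simp
    also have "\<dots> \<le> d" using card_image_le[of "E `` {v}"] degree[of v] by (meson finite_Image order_trans)
    finally show ?thesis .
  qed
  have "?\<beta> * card U \<le> ?\<beta> * real (\<Sum>W\<in>?P. card W)"
    using U_le c_pos by (intro mult_left_mono of_nat_mono) auto
  also have "\<dots> = (\<Sum>W\<in>?P. ?\<beta> * card W)" by (simp add: sum_distrib_left)
  also have "\<dots> \<le> (\<Sum>W\<in>?P. real (card {v \<in> ?N. v \<in> E `` W}))"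
    by (rule sum_mono) (rule part)
  also have "\<dots> = real (\<Sum>W\<in>?P. card {v \<in> ?N. v \<in> E `` W})" by simp
  also have "(\<Sum>W\<in>?P. card {v \<in> ?N. v \<in> E `` W}) = (\<Sum>v\<in>?N. card {W \<in> ?P. v \<in> E `` W})"
    by (rule sum_multicount_gen) (use finU finN in auto)
  also have "\<dots> \<le> of_nat (card ?N) * d" by (rule sum_bounded_above) (rule touched)
  finally have "?\<beta> * card U \<le> real (card ?N) * d" by simp
  then show ?thesis using d_pos by (simp add: divide_simps mult_ac)
qed

end

section \<open>Graphs as relations\<close>

lemma (in graph) induce_subgraph_component_iff:
  assumes "S \<subseteq> verts G"
  shows "graph_component (G \<restriction> S) C \<longleftrightarrow> (\<exists>u\<in>S. C = G \<restriction> comp_of (arcs_ends G) S u)"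
proof -
  have H_sym: "sym_digraph (G \<restriction> S)"
    by (rule induced_graph_imp_graph) (rule induced_induce[OF assms])
  then interpret H: sym_digraph "G \<restriction> S" .
  have ends: "arcs_ends (G \<restriction> S) = Restr (arcs_ends G) S"
    by (auto simp: arcs_ends_conv)
  have reach: "u \<rightarrow>\<^sup>*\<^bsub>G \<restriction> S\<^esub> v \<longleftrightarrow> v \<in> comp_of (arcs_ends G) S u" if "u \<in> S" for u v
    using that comp_of_subset[OF that, of "arcs_ends G"] H.reachable_conv[of u v]
    unfolding ends comp_of_def by auto
  have scc: "H.scc_of u = comp_of (arcs_ends G) S u" if "u \<in> S" for u
    using symmetric_reachable[OF H.sym_arcs] reach[OF that] unfolding H.scc_of_def by blast
  have ind: "(G \<restriction> S) \<restriction> T = G \<restriction> T" if "T \<subseteq> S" for T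
    using that by (auto simp: induce_subgraph_def)
  have "graph_component (G \<restriction> S) C \<longleftrightarrow> C \<in> (\<lambda>u. (G \<restriction> S) \<restriction> H.scc_of u) ` S"
    unfolding H.graph_component_iff_sccs H.sccs_conv_sccs_verts H.sccs_verts_conv_scc_of by (simp add: image_image)
  also have "\<dots> \<longleftrightarrow> (\<exists>u\<in>S. C = G \<restriction> comp_of (arcs_ends G) S u)"
    using scc ind comp_of_subset[of _ S "arcs_ends G"] by (auto simp: image_iff)
  finally show ?thesis .
qed

lemma (in wf_digraph) ext_neighbours_conv: "U \<subseteq> verts G \<Longrightarrow> ext_neighbours G U = ext_nbhd (arcs_ends G) U"
  unfolding ext_neighbours_def ext_nbhd_def using adj_in_verts by blast

lemma (in wf_digraph) ext_neighbours_induce: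
  "U \<subseteq> S \<Longrightarrow> ext_neighbours (G \<restriction> S) U = ext_nbhd (arcs_ends G) U \<inter> S"
  unfolding ext_neighbours_def ext_nbhd_def by (auto simp: arcs_ends_conv)

lemma (in graph) card_neighbours: "card (arcs_ends G `` {v}) = out_degree G v"
proof -
  have "arcs_ends G `` {v} = head G ` out_arcs G v"
    by (auto simp: arcs_ends_conv)
  moreover have "inj_on (head G) (out_arcs G v)"
    by (intro inj_onI no_multi_arcs) (auto simp: arc_to_ends_def)
  ultimately show ?thesis by (simp add: card_image out_degree_def)
qed

section \<open>The random deletion\<close>

text \<open>
  The three alternatives are the ways in which a deletion can fail: a small connected set loses \<open>s\<close>
  neighbours, a large one loses half of the neighbours that expansion guarantees it, or too many
  vertices are deleted altogether. In the second case a set of size \<open>k\<close> contributes the \<open>k\<close>-th power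
  of \<open>Q * p powr (c / 2) \<le> 1\<close>, so the smallest size \<open>K + 1\<close> dominates.
\<close>

lemma (in bounded_degree) prob_bad_deletion_le:
  fixes p s c t Q :: real and K :: nat
  defines "Q \<equiv> real d ^ 2 * 2 ^ d"
  assumes p: "0 < p" "p \<le> 1" and q: "Q * p powr (c / 2) \<le> 1" and t: "0 < t"
  shows "measure_pmf.prob (Pi_pmf V False (\<lambda>_. bernoulli_pmf p))
     {D. (\<exists>U\<subseteq>V. conn_set E U \<and> card U \<le> K \<and> s \<le> card {v \<in> ext_nbhd E U. D v}) \<or>
         (\<exists>U\<subseteq>V. conn_set E U \<and> K < card U \<and> c / 2 * card U \<le> card {v \<in> ext_nbhd E U. D v}) \<or>
         t \<le> card {v \<in> V. D v}}
     \<le> K * (card V * Q ^ K * p powr s) + card V * (card V * (Q * p powr (c / 2)) ^ Suc K)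
       + card V * p / t"
proof -
  let ?P = "measure_pmf.prob (Pi_pmf V False (\<lambda>_. bernoulli_pmf p))"
  define X where "X k r = {D. \<exists>U\<subseteq>V. conn_set E U \<and> card U = k \<and> r \<le> real (card {v \<in> ext_nbhd E U. D v})}" for k r
  have X: "?P (X k r) \<le> card V * Q ^ k * p powr r" for k r
    unfolding X_def Q_def by (rule prob_conn_set_many_deleted[OF p])
  have "1 \<le> real d ^ 2 * 2 ^ d" using d_pos by (intro mult_ge1_I one_le_power) auto
  then have Q1: "1 \<le> Q" by (simp add: Q_def)
  let ?A = "\<Union>k\<in>{1..K}. X k s" and ?B = "\<Union>k\<in>{Suc K..card V}. X k (c / 2 * k)"
    and ?C = "{D. t \<le> real (card {v \<in> V. D v})}"
  have card_pos: "1 \<le> card U" if "U \<subseteq> V" "conn_set E U" for U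
    using that finite_subset[OF that(1) finite_V] by (auto simp: conn_set_def Suc_le_eq card_gt_0_iff)
  have card_le: "card U \<le> card V" if "U \<subseteq> V" for U
    using that by (intro card_mono) auto
  have "?P {D. (\<exists>U\<subseteq>V. conn_set E U \<and> card U \<le> K \<and> s \<le> card {v \<in> ext_nbhd E U. D v}) \<or>
         (\<exists>U\<subseteq>V. conn_set E U \<and> K < card U \<and> c / 2 * card U \<le> card {v \<in> ext_nbhd E U. D v}) \<or>
         t \<le> card {v \<in> V. D v}} \<le> ?P (?A \<union> ?B \<union> ?C)"
  proof (rule measure_pmf.finite_measure_mono)
    show "{D. (\<exists>U\<subseteq>V. conn_set E U \<and> card U \<le> K \<and> s \<le> card {v \<in> ext_nbhd E U. D v}) \<or>
         (\<exists>U\<subseteq>V. conn_set E U \<and> K < card U \<and> c / 2 * card U \<le> card {v \<in> ext_nbhd E U. D v}) \<or>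
         t \<le> card {v \<in> V. D v}} \<subseteq> ?A \<union> ?B \<union> ?C"
    proof
      fix D assume "D \<in> {D. (\<exists>U\<subseteq>V. conn_set E U \<and> card U \<le> K \<and> s \<le> card {v \<in> ext_nbhd E U. D v}) \<or>
         (\<exists>U\<subseteq>V. conn_set E U \<and> K < card U \<and> c / 2 * card U \<le> card {v \<in> ext_nbhd E U. D v}) \<or>
         t \<le> card {v \<in> V. D v}}"
      then consider
          U where "U \<subseteq> V" "conn_set E U" "card U \<le> K" "s \<le> card {v \<in> ext_nbhd E U. D v}"
        | U where "U \<subseteq> V" "conn_set E U" "K < card U" "c / 2 * card U \<le> card {v \<in> ext_nbhd E U. D v}"
        | "t \<le> card {v \<in> V. D v}" by blast
      then show "D \<in> ?A \<union> ?B \<union> ?C"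
      proof cases
        case 1
        then have "D \<in> X (card U) s" "card U \<in> {1..K}" using card_pos unfolding X_def by auto
        then show ?thesis by blast
      next
        case 2
        then have "D \<in> X (card U) (c / 2 * card U)" "card U \<in> {Suc K..card V}"
          using card_le unfolding X_def by auto
        then show ?thesis by blast
      qed simp
    qed
  qed simp
  also have "\<dots> \<le> ?P ?A + ?P ?B + ?P ?C"
    by (intro order_trans[OF measure_Un_le] add_mono) auto
  also have "?P ?A \<le> (\<Sum>k\<in>{1..K}. ?P (X k s))" by (rule measure_UNION_le) auto
  also have "\<dots> \<le> (\<Sum>k\<in>{1..K}. card V * Q ^ K * p powr s)"
    using Q1 by (intro sum_mono order_trans[OF X] mult_right_mono mult_left_mono power_increasing) auto
  also have "\<dots> = K * (card V * Q ^ K * p powr s)" by simp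
  also have "?P ?B \<le> (\<Sum>k\<in>{Suc K..card V}. ?P (X k (c / 2 * k)))" by (rule measure_UNION_le) auto
  also have "\<dots> \<le> (\<Sum>k\<in>{Suc K..card V}. card V * (Q * p powr (c / 2)) ^ Suc K)"
  proof (rule sum_mono)
    fix k assume k: "k \<in> {Suc K..card V}"
    have "?P (X k (c / 2 * k)) \<le> card V * Q ^ k * p powr (c / 2 * k)" by (rule X)
    also have "p powr (c / 2 * k) = (p powr (c / 2)) ^ k"
      using p powr_realpow[of "p powr (c / 2)" k] by (simp add: powr_powr)
    also have "card V * Q ^ k * (p powr (c / 2)) ^ k = card V * (Q * p powr (c / 2)) ^ k"
      by (simp add: power_mult_distrib)
    also have "\<dots> \<le> card V * (Q * p powr (c / 2)) ^ Suc K"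
      using k q Q1 by (intro mult_left_mono power_decreasing) auto
    finally show "?P (X k (c / 2 * k)) \<le> card V * (Q * p powr (c / 2)) ^ Suc K" .
  qed
  also have "\<dots> = card {Suc K..card V} * (card V * (Q * p powr (c / 2)) ^ Suc K)" by simp
  also have "\<dots> \<le> card V * (card V * (Q * p powr (c / 2)) ^ Suc K)"
    using Q1 by (intro mult_right_mono) auto
  also have "?P ?C \<le> card V * p / t"
    by (rule prob_many_deleted_Markov) (use p t in auto)
  finally show ?thesis by simp
qed

lemma expander_bound:
  assumes "expander f H" "U \<subseteq> verts H" "U \<noteq> {}" "2 * card U \<le> card (verts H)"
  shows "f (card U) * card U \<le> card (ext_neighbours H U)"
proof -
  have "real (card U) \<le> real (card (verts H)) / 2" using assms(4) by linarith
  then show ?thesis using assms(1-3) unfolding expander_def by blast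
qed

text \<open>
  A component other than the giant one has at most \<open>K\<close> vertices, and all its neighbours are deleted.
  Hence it has at most \<open>s\<close> neighbours, whereas expansion provides more than \<open>s\<close> as soon as its size
  reaches \<open>T\<close>.
\<close>

lemma (in graph) survivors_of_sparse_deletion:
  fixes f :: "nat \<Rightarrow> real" and s :: real
  assumes "sparse_deletion (verts G) (arcs_ends G) d D c K"
    and f: "expander f G"
    and T: "\<And>k. T \<le> k \<Longrightarrow> k \<le> card (verts G) div 2 \<Longrightarrow> s < k * f k"
    and s: "\<And>U. U \<subseteq> verts G \<Longrightarrow> conn_set (arcs_ends G) U \<Longrightarrow> card U \<le> K
          \<Longrightarrow> card (ext_nbhd (arcs_ends G) U \<inter> D) \<le> s"
  obtains C where "graph_component (G \<restriction> (verts G - D)) C"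
    and "card (verts G) \<le> card (verts C) + card D * (1 + d * K)"
    and "const_expander (min (1 / K) (c / 2) / d) C"
    and "\<And>C'. graph_component (G \<restriction> (verts G - D)) C' \<Longrightarrow> C' \<noteq> C \<Longrightarrow> card (verts C') \<le> T - 1"
proof -
  interpret sparse_deletion "verts G" "arcs_ends G" d D c K by fact
  let ?S = "verts G - D"
  have comps: "graph_component (G \<restriction> ?S) C \<longleftrightarrow> (\<exists>u\<in>?S. C = G \<restriction> comp u)" for C
    by (rule induce_subgraph_component_iff) auto
  obtain u where u: "u \<in> ?S" "card (verts G) < 2 * card (comp u)"
    "card (verts G) \<le> card (comp u) + card D * (1 + d * K)" by (rule giant_exists)
  show ?thesis
  proof (rule that[of "G \<restriction> comp u"])
    show "graph_component (G \<restriction> ?S) (G \<restriction> comp u)" using u comps by blast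
    show "card (verts G) \<le> card (verts (G \<restriction> comp u)) + card D * (1 + d * K)" using u by simp
    show "const_expander (min (1 / K) (c / 2) / d) (G \<restriction> comp u)"
      unfolding expander_def
    proof (intro conjI ballI allI impI; (elim conjE)?)
      show "0 < min (1 / real K) (c / 2) / d" using K_pos c_pos d_pos by simp
      fix U assume "U \<subseteq> verts (G \<restriction> comp u)" "real (card U) \<le> real (card (verts (G \<restriction> comp u))) / 2"
      then have U: "U \<subseteq> comp u" "2 * card U \<le> card (comp u)" by simp_all
      show "min (1 / real K) (c / 2) / d * card U \<le> card (ext_neighbours (G \<restriction> comp u) U)"
        using subset_expands[OF u(1) U] ext_neighbours_induce[OF U(1)] by simp
    qed
    fix C' assume C': "graph_component (G \<restriction> ?S) C'" "C' \<noteq> G \<restriction> comp u"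
    then obtain v where v: "v \<in> ?S" "C' = G \<restriction> comp v" using comps by blast
    then have "comp v \<noteq> comp u" using C' by auto
    then have small: "card (comp v) \<le> K"
      using comp_small_or_giant[OF v(1)] giant_unique[OF v(1) u(1)] u(2) by blast
    have sub: "comp v \<subseteq> verts G" using comp_subset[OF v(1)] by blast
    have half: "card (comp v) \<le> card (verts G) div 2" using small K_le by linarith
    have "\<not> T \<le> card (comp v)"
    proof
      assume "T \<le> card (comp v)"
      then have "s < card (comp v) * f (card (comp v))" using T half by blast
      also have "\<dots> \<le> card (ext_neighbours G (comp v))"
        using expander_bound[OF f sub comp_nonempty] half by (simp add: mult.commute)
      also have "ext_neighbours G (comp v) = ext_nbhd (arcs_ends G) (comp v) \<inter> D"
        using ext_nbhd_comp_subset[OF v(1)] by (auto simp: ext_neighbours_conv[OF sub])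
      also have "card \<dots> \<le> s" by (rule s[OF sub conn_set_comp_of[OF sym_E] small])
      finally show False by simp
    qed
    then show "card (verts C') \<le> T - 1" using v by simp
  qed
qed

lemma comp_threshold_gt:
  assumes "K \<in> {1..n div 2}" "\<And>k. k \<in> {K..n div 2} \<Longrightarrow> 1 / \<alpha> < k * f k"
    and "comp_threshold \<alpha> n f \<le> k" "k \<le> n div 2"
  shows "1 / \<alpha> < k * f k"
proof -
  have "comp_threshold \<alpha> n f \<in> {1..n div 2} \<and>
      (\<forall>k\<in>{comp_threshold \<alpha> n f..n div 2}. real k * f k > 1 / \<alpha>)"
    unfolding comp_threshold_def by (rule LeastI[of _ K]) (use assms in auto)
  then show ?thesis using assms by auto
qed

lemma tendsto_real_neg_powr:
  fixes a :: real
  assumes "a < 0"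
  shows "(\<lambda>n. real n powr a) \<longlonglongrightarrow> 0"
  using assms filterlim_real_sequentially by (rule tendsto_neg_powr)

text \<open>
  The threshold for the loss of a small connected set is \<open>\<lfloor>1 / \<alpha>\<rfloor> + 1\<close>, the least integer
  above \<open>1 / \<alpha>\<close>: a number of neighbours greater than \<open>1 / \<alpha>\<close> is at least this integer.
  The resulting exponent \<open>1 - \<alpha> * (\<lfloor>1 / \<alpha>\<rfloor> + 1)\<close> of \<open>n\<close> is negative and independent of the graph and
  of \<open>f\<close>, even when \<open>k * f k\<close> comes arbitrarily close to \<open>1 / \<alpha>\<close> along the sequence of graphs.
  For large sets, \<open>K \<ge> 6 / (\<alpha> * c)\<close> makes \<open>p powr (c / 2 * K)\<close> at most \<open>n powr (- 3)\<close>,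
  which beats the two factors \<open>n\<close> for the starting point of a walk and for the size of the set.
  The number of deleted vertices is compared with \<open>n powr (1 - \<alpha> / 2)\<close>, which is sublinear but larger
  than its mean \<open>n powr (1 - \<alpha>)\<close> by a power of \<open>n\<close>.
\<close>

lemma prob_survivors_ge:
  fixes G :: "('a, 'b) pre_digraph" and f :: "nat \<Rightarrow> real" and \<alpha> c \<Delta> Q :: real and d K n :: nat
  defines "d \<equiv> max 1 (nat \<lfloor>\<Delta>\<rfloor>)"
  defines "Q \<equiv> real d ^ 2 * 2 ^ d"
  assumes \<alpha>: "0 < \<alpha>" and c: "0 < c"
    and G: "graph G" "card (verts G) = n" "\<And>v. v \<in> verts G \<Longrightarrow> real (out_degree G v) \<le> \<Delta>"
    and f: "expander f G" "\<And>a. a \<in> {1..n div 2} \<Longrightarrow> c \<le> f a"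
    and K: "6 / (\<alpha> * c) \<le> K" "2 * K \<le> n"
    and q: "Q * (real n powr - \<alpha>) powr (c / 2) \<le> 1"
    and few: "(1 + d * K) * real n powr (1 - \<alpha> / 2) < n"
  shows "1 - (K * Q ^ K * real n powr (1 - \<alpha> * (\<lfloor>1 / \<alpha>\<rfloor> + 1)) + Q ^ Suc K * real n powr (-1)
            + real n powr (- (\<alpha> / 2)))
    \<le> measure_pmf.prob (vertex_deletion (real n powr (- \<alpha>)) G)
         {H. \<exists>C. graph_component H C \<and>
                 real (card (verts C)) \<ge> real n - (1 + d * K) * real n powr (1 - \<alpha> / 2) \<and>
                 const_expander (min (1 / K) (c / 2) / d) C \<and>
                 (\<forall>C'. graph_component H C' \<and> C' \<noteq> C \<longrightarrow>
                       card (verts C') \<le> comp_threshold \<alpha> n f - 1)}"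
    (is "1 - ?err \<le> measure_pmf.prob _ ?Good")
proof -
  interpret G: graph G by fact
  let ?V = "verts G" and ?E = "arcs_ends G"
  have "0 < 6 / (\<alpha> * c)" using \<alpha> c by simp
  then have K1: "1 \<le> K" using K(1) by linarith
  then have n1: "1 \<le> n" using K by linarith
  interpret bounded_degree ?V ?E d
  proof
    show "card (?E `` {v}) \<le> d" for v
    proof (cases "v \<in> ?V")
      case True
      then have "out_degree G v \<le> nat \<lfloor>\<Delta>\<rfloor>" using G(3)[OF True] by (simp add: le_nat_floor)
      then show ?thesis by (simp add: G.card_neighbours d_def)
    next
      case False
      then have "?E `` {v} = {}" using G.adj_in_verts by blast
      then show ?thesis by (simp only: card.empty)
    qed
  qed (use G.adj_in_verts G.sym_arcs in \<open>auto simp: symmetric_def d_def\<close>)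
  define p where "p = real n powr - \<alpha>"
  define t where "t = real n powr (1 - \<alpha> / 2)"
  define s where "s = (of_int \<lfloor>1 / \<alpha>\<rfloor> + 1 :: real)"
  have p: "0 < p" "p \<le> 1" using n1 \<alpha> powr_mono[of "- \<alpha>" 0 "real n"] by (auto simp: p_def)
  have t: "0 < t" using n1 by (simp add: t_def)
  let ?M = "Pi_pmf ?V False (\<lambda>_. bernoulli_pmf p)"
  let ?Bad = "{D. (\<exists>U\<subseteq>?V. conn_set ?E U \<and> card U \<le> K \<and> s \<le> card {v \<in> ext_nbhd ?E U. D v}) \<or>
         (\<exists>U\<subseteq>?V. conn_set ?E U \<and> K < card U \<and> c / 2 * card U \<le> card {v \<in> ext_nbhd ?E U. D v}) \<or>
         t \<le> card {v \<in> ?V. D v}}"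
  have good: "G \<restriction> {v \<in> ?V. \<not> D v} \<in> ?Good" if "D \<notin> ?Bad" for D
  proof -
    let ?D = "{v \<in> ?V. D v}"
    have ext_D: "ext_nbhd ?E U \<inter> ?D = {v \<in> ext_nbhd ?E U. D v}" for U
      using ext_nbhd_subset[of U] by blast
    have no_small: "card {v \<in> ext_nbhd ?E U. D v} < s" if "U \<subseteq> ?V" "conn_set ?E U" "card U \<le> K" for U
      using \<open>D \<notin> ?Bad\<close> that by (metis (mono_tags, lifting) mem_Collect_eq not_le)
    have no_large: "card {v \<in> ext_nbhd ?E U. D v} < c / 2 * card U" if "U \<subseteq> ?V" "conn_set ?E U" "K < card U" for U
      using \<open>D \<notin> ?Bad\<close> that by (metis (mono_tags, lifting) mem_Collect_eq not_le)
    have "real (card ?D) \<le> t" using that by simp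
    then have "real (1 + d * K) * card ?D \<le> real (1 + d * K) * t" by (rule mult_left_mono) simp
    then have card_D: "real (card ?D * (1 + d * K)) \<le> real (1 + d * K) * t"
      by (simp only: of_nat_mult mult.commute)
    have sparse: "sparse_deletion ?V ?E d ?D c K"
    proof unfold_locales
      fix U assume U: "U \<subseteq> ?V" "U \<noteq> {}" "2 * card U \<le> card ?V"
      have "card U \<noteq> 0" using U finite_subset[OF U(1)] by simp
      then have "c * card U \<le> f (card U) * card U" using U G(2) by (intro mult_right_mono f) auto
      also have "\<dots> \<le> card (ext_neighbours G U)" using expander_bound[OF f(1) U] by simp
      finally show "c * card U \<le> card (ext_nbhd ?E U)" by (simp add: G.ext_neighbours_conv[OF U(1)])
    next
      fix U assume "U \<subseteq> ?V" "conn_set ?E U" "K < card U"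
      then show "card (ext_nbhd ?E U \<inter> ?D) < c / 2 * card U" unfolding ext_D by (rule no_large)
    next
      have "real (card ?D * (1 + d * K)) < n" using card_D few unfolding t_def by linarith
      then show "card ?D * (1 + d * K) < card ?V" using G(2) by (simp only: of_nat_less_iff)
    qed (use c K1 K G in auto)
    have thr: "1 / \<alpha> < k * f k" if "comp_threshold \<alpha> n f \<le> k" "k \<le> card ?V div 2" for k
    proof (rule comp_threshold_gt[OF _ _ that[unfolded G(2)]])
      show "K \<in> {1..n div 2}" using K K1 by auto
      fix k assume k: "k \<in> {K..n div 2}"
      have "1 / \<alpha> < 6 / \<alpha>" using \<alpha> by (simp add: divide_simps)
      also have "6 / \<alpha> = 6 / (\<alpha> * c) * c" using c by simp
      also have "\<dots> \<le> k * f k"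
        using k K K1 c \<alpha> f(2)[of k] by (intro mult_mono) (auto intro: order_trans)
      finally show "1 / \<alpha> < k * f k" .
    qed
    have sm: "card (ext_nbhd ?E U \<inter> ?D) \<le> 1 / \<alpha>" if "U \<subseteq> ?V" "conn_set ?E U" "card U \<le> K" for U
    proof -
      have "real (card (ext_nbhd ?E U \<inter> ?D)) < s"
        using no_small[OF that] unfolding ext_D .
      then have "int (card (ext_nbhd ?E U \<inter> ?D)) \<le> \<lfloor>1 / \<alpha>\<rfloor>" unfolding s_def by linarith
      then show ?thesis by linarith
    qed
    obtain C where C: "graph_component (G \<restriction> (?V - ?D)) C"
      "card ?V \<le> card (verts C) + card ?D * (1 + d * K)"
      "const_expander (min (1 / K) (c / 2) / d) C"
      "\<And>C'. graph_component (G \<restriction> (?V - ?D)) C' \<Longrightarrow> C' \<noteq> C \<Longrightarrow> card (verts C') \<le> comp_threshold \<alpha> n f - 1"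
      using G.survivors_of_sparse_deletion[OF sparse f(1) thr sm] by blast
    have eq: "?V - ?D = {v \<in> ?V. \<not> D v}" by auto
    have "real n \<le> card (verts C) + real (card ?D * (1 + d * K))"
      using C(2) G(2) by (simp only: flip: of_nat_add of_nat_le_iff[where 'a = real])
    then have "real n - (1 + d * K) * t \<le> card (verts C)" using card_D by linarith
    then show ?thesis using C unfolding eq t_def by blast
  qed
  have "measure_pmf.prob ?M ?Bad \<le> K * (n * Q ^ K * p powr s) + n * (n * (Q * p powr (c / 2)) ^ Suc K) + n * p / t"
    unfolding Q_def G(2)[symmetric]
    by (rule prob_bad_deletion_le) (use p q t in \<open>simp_all add: p_def Q_def\<close>)
  also have "\<dots> \<le> ?err"
  proof (intro add_mono)
    have npow: "n * real n powr x = real n powr (1 + x)" for x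
      using n1 by (simp add: powr_add)
    have "n * p powr s = real n powr (1 - \<alpha> * s)"
      unfolding p_def powr_powr npow by simp
    moreover have "K * (n * Q ^ K * p powr s) = K * Q ^ K * (n * p powr s)" by (simp add: mult_ac)
    ultimately have "K * (n * Q ^ K * p powr s) = K * Q ^ K * real n powr (1 - \<alpha> * s)"
      by (simp only:)
    then show "K * (n * Q ^ K * p powr s) \<le> K * Q ^ K * real n powr (1 - \<alpha> * (\<lfloor>1 / \<alpha>\<rfloor> + 1))"
      by (simp only: s_def of_int_add of_int_1 order.refl)
    have "(p powr (c / 2)) ^ Suc K = (p powr (c / 2)) powr real (Suc K)"
      using p by (intro powr_realpow[symmetric]) simp
    also have "\<dots> = real n powr (- \<alpha> * (c / 2) * Suc K)" by (simp only: p_def powr_powr)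
    finally have pow: "(p powr (c / 2)) ^ Suc K = real n powr (- \<alpha> * (c / 2) * Suc K)" .
    have "n * (n * (p powr (c / 2)) ^ Suc K) = real n powr (2 - \<alpha> * c / 2 * Suc K)"
      by (simp only: pow npow) (simp add: algebra_simps)
    also have "\<dots> \<le> real n powr (-1)"
    proof (rule powr_mono)
      have "6 \<le> \<alpha> * c * K" using K(1) \<alpha> c by (simp add: field_simps)
      also have "\<dots> \<le> \<alpha> * c * Suc K" using \<alpha> c by (intro mult_left_mono) auto
      finally show "2 - \<alpha> * c / 2 * Suc K \<le> -1" by simp
    qed (use n1 in simp)
    finally have "Q ^ Suc K * (n * (n * (p powr (c / 2)) ^ Suc K)) \<le> Q ^ Suc K * real n powr (-1)"
      by (intro mult_left_mono) (simp_all add: Q_def)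
    then show "n * (n * (Q * p powr (c / 2)) ^ Suc K) \<le> Q ^ Suc K * real n powr (-1)"
      by (simp only: power_mult_distrib mult_ac)
    have "n * p / t = real n powr (1 + - \<alpha> - (1 - \<alpha> / 2))"
      unfolding p_def t_def npow powr_diff ..
    then show "n * p / t \<le> real n powr (- (\<alpha> / 2))" by (simp add: field_simps)
  qed
  finally have bad: "measure_pmf.prob ?M ?Bad \<le> ?err" .
  have "1 - measure_pmf.prob ?M ?Bad = measure_pmf.prob ?M (- ?Bad)"
    by (subst measure_pmf.prob_compl[symmetric]) (simp_all add: Compl_eq_Diff_UNIV)
  also have "\<dots> \<le> measure_pmf.prob ?M ((\<lambda>D. G \<restriction> {v \<in> ?V. \<not> D v}) -` ?Good)"
  proof (rule measure_pmf.finite_measure_mono)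
    show "- ?Bad \<subseteq> (\<lambda>D. G \<restriction> {v \<in> ?V. \<not> D v}) -` ?Good"
    proof
      fix D assume "D \<in> - ?Bad"
      then have "D \<notin> ?Bad" by (rule ComplD)
      then show "D \<in> (\<lambda>D. G \<restriction> {v \<in> ?V. \<not> D v}) -` ?Good" by (intro vimageI2 good)
    qed
  qed simp
  also have "\<dots> = measure_pmf.prob (vertex_deletion p G) ?Good"
    by (simp only: vertex_deletion_def measure_map_pmf)
  finally show ?thesis using bad unfolding p_def by linarith
qed

theorem theorem1p2:
  fixes \<alpha> c \<Delta> :: real
  assumes "0 < \<alpha>" and "0 < c" and "0 < \<Delta>"
  shows "\<exists>\<beta>>0. \<forall>(I :: nat set) (G :: nat \<Rightarrow> ('a, 'b) pre_digraph) (f :: nat \<Rightarrow> nat \<Rightarrow> real).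
    infinite I \<and>
    (\<forall>n\<in>I. graph (G n) \<and> card (verts (G n)) = n \<and>
       (\<forall>v\<in>verts (G n). real (out_degree (G n) v) \<le> \<Delta>) \<and>
       expander (f n) (G n) \<and>
       (\<forall>a\<in>{1..n div 2}. c \<le> f n a)) \<longrightarrow>
    (\<exists>g \<in> o(\<lambda>n. real n).
      ((\<lambda>n. measure_pmf.prob (vertex_deletion (real n powr (- \<alpha>)) (G n))
         {H. \<exists>C. graph_component H C \<and>
                 real (card (verts C)) \<ge> real n - g n \<and>
                 const_expander \<beta> C \<and>
                 (\<forall>C'. graph_component H C' \<and> C' \<noteq> C \<longrightarrow>
                       card (verts C') \<le> comp_threshold \<alpha> n (f n) - 1)})
       \<longlongrightarrow> 1) (inf sequentially (principal I)))"
proof -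
  define d where "d = max 1 (nat \<lfloor>\<Delta>\<rfloor>)"
  define K where "K = nat \<lceil>6 / (\<alpha> * c)\<rceil>"
  define Q where "Q = real d ^ 2 * 2 ^ d"
  define g where "g n = real (1 + d * K) * real n powr (1 - \<alpha> / 2)" for n :: nat
  define err where "err n = K * Q ^ K * real n powr (1 - \<alpha> * (\<lfloor>1 / \<alpha>\<rfloor> + 1)) + Q ^ Suc K * real n powr (-1)
            + real n powr (- (\<alpha> / 2))" for n :: nat
  have K: "6 / (\<alpha> * c) \<le> K" by (simp add: K_def real_nat_ceiling_ge)
  have "0 < 6 / (\<alpha> * c)" using assms by simp
  then have K_pos: "0 < K" using K by linarith
  \<comment> \<open>The first power of \<open>n\<close> in the error tends to 0 because \<open>1 / \<alpha>\<close> is rounded up strictly.\<close>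
  have frac: "1 - \<alpha> * (\<lfloor>1 / \<alpha>\<rfloor> + 1) < 0"
  proof -
    have "1 / \<alpha> < \<lfloor>1 / \<alpha>\<rfloor> + 1" by linarith
    then show ?thesis using assms(1) by (simp add: field_simps)
  qed
  have err: "err \<longlonglongrightarrow> 0"
    unfolding err_def
    by (rule tendsto_eq_intros tendsto_real_neg_powr frac | use assms in simp)+
  have half: "(\<lambda>n. (1 + d * K) * real n powr (- (\<alpha> / 2))) \<longlonglongrightarrow> 0"
    by (rule tendsto_mult_right_zero, rule tendsto_real_neg_powr) (use assms in simp)
  have g_eq: "g n / n = (1 + d * K) * real n powr (- (\<alpha> / 2))" if "1 \<le> n" for n :: nat
  proof -
    have "g n = (1 + d * K) * real n powr (1 + - (\<alpha> / 2))" by (simp add: g_def)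
    then show ?thesis using that unfolding powr_add by simp
  qed
  have g_small: "g \<in> o(\<lambda>n. real n)"
  proof (rule smalloI_tendsto)
    have "eventually (\<lambda>n. (1 + d * K) * real n powr (- (\<alpha> / 2)) = g n / n) sequentially"
      using eventually_ge_at_top[of 1] by eventually_elim (use g_eq in simp)
    with half show "(\<lambda>n. g n / n) \<longlonglongrightarrow> 0" by (rule Lim_transform_eventually)
    show "eventually (\<lambda>n. real n \<noteq> 0) sequentially"
      using eventually_gt_at_top[of 0] by eventually_elim simp
  qed
  have q_small: "(\<lambda>n. Q * real n powr (- \<alpha> * (c / 2))) \<longlonglongrightarrow> 0"
    by (rule tendsto_mult_right_zero, rule tendsto_real_neg_powr) (use assms in simp)
  have ev_q: "eventually (\<lambda>n. Q * (real n powr - \<alpha>) powr (c / 2) \<le> 1) sequentially"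
    using order_tendstoD(2)[OF q_small, of 1] by (auto simp: powr_powr elim: eventually_mono)
  have ev_g: "eventually (\<lambda>n. g n < n) sequentially"
    using order_tendstoD(2)[OF half, of 1, simplified] eventually_ge_at_top[of 1]
  proof eventually_elim
    case (elim n)
    then have "g n / n < 1" using g_eq by simp
    then show ?case using elim by (simp add: field_simps)
  qed
  show ?thesis
  proof (intro exI[of _ "min (1 / K) (c / 2) / d"] conjI allI impI; (elim conjE)?)
    show "0 < min (1 / real K) (c / 2) / d" using K_pos assms by (simp add: d_def)
  next
    fix I :: "nat set" and G :: "nat \<Rightarrow> ('a, 'b) pre_digraph" and f :: "nat \<Rightarrow> nat \<Rightarrow> real"
    assume hyp: "\<forall>n\<in>I. graph (G n) \<and> card (verts (G n)) = n \<and>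
       (\<forall>v\<in>verts (G n). real (out_degree (G n) v) \<le> \<Delta>) \<and>
       expander (f n) (G n) \<and> (\<forall>a\<in>{1..n div 2}. c \<le> f n a)"
    let ?P = "\<lambda>n. measure_pmf.prob (vertex_deletion (real n powr (- \<alpha>)) (G n))
         {H. \<exists>C. graph_component H C \<and>
                 real (card (verts C)) \<ge> real n - g n \<and>
                 const_expander (min (1 / K) (c / 2) / d) C \<and>
                 (\<forall>C'. graph_component H C' \<and> C' \<noteq> C \<longrightarrow>
                       card (verts C') \<le> comp_threshold \<alpha> n (f n) - 1)}"
    have "eventually (\<lambda>n. n \<in> I \<longrightarrow> 1 - err n \<le> ?P n) sequentially"
      using ev_q ev_g eventually_ge_at_top[of "2 * K"]
    proof eventually_elim
      case (elim n)
      show ?case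
      proof
        assume "n \<in> I"
        then show "1 - err n \<le> ?P n"
          using prob_survivors_ge[of \<alpha> c "G n" n \<Delta> "f n" K] hyp assms K elim
          unfolding err_def g_def d_def Q_def by simp
      qed
    qed
    then have low: "eventually (\<lambda>n. 1 - err n \<le> ?P n) (inf sequentially (principal I))"
      by (simp add: eventually_inf_principal)
    have lim: "((\<lambda>n. 1 - err n) \<longlongrightarrow> 1) (inf sequentially (principal I))"
      by (rule tendsto_mono[of _ sequentially]) (use tendsto_diff[OF tendsto_const err] in simp_all)
    have "(?P \<longlongrightarrow> 1) (inf sequentially (principal I))"
      by (rule tendsto_sandwich[OF low _ lim tendsto_const]) simp
    then show "\<exists>g \<in> o(\<lambda>n. real n).
      ((\<lambda>n. measure_pmf.prob (vertex_deletion (real n powr (- \<alpha>)) (G n))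
         {H. \<exists>C. graph_component H C \<and>
                 real (card (verts C)) \<ge> real n - g n \<and>
                 const_expander (min (1 / K) (c / 2) / d) C \<and>
                 (\<forall>C'. graph_component H C' \<and> C' \<noteq> C \<longrightarrow>
                       card (verts C') \<le> comp_threshold \<alpha> n (f n) - 1)})
       \<longlongrightarrow> 1) (inf sequentially (principal I))"
      using g_small by blast
  qed
qed

end
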